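(* Let $p$ be a prime, $m\ge1$ and $r\ge1$ integers, and $n=p^m$. For $\beta\in\mathbb{Z}_{p^m}$ let $p^t=\gcd(\beta,p^m)$ with $0\le t\le m$, and let $N_\beta$ be the number of matrices $X\in\mathrm{GL}_r(\mathbb{Z}_{p^m})$ with $\mathrm{tr}\,X=\beta$. Then $$N_\beta=\begin{cases}p^{m(r^2-1)}\left(\prod_{i=1}^r(1-p^{-i})-(-1)^rp^{-r(r+1)/2}\right), & t=0,\\[4pt] p^{m(r^2-1)}\left(\prod_{i=1}^r(1-p^{-i})+(-1)^rp^{-r(r+1)/2}(p-1)\right), & \text{otherwise}.\end{cases}$$
   Context: $\mathbb{Z}_{p^m}=\mathbb{Z}/p^m\mathbb{Z}$ and $\mathrm{GL}_r(\mathbb{Z}_{p^m})$ is the group of invertible $r\times r$ matrices over it; $\gcd(\beta,p^m)$ means the gcd of any integer representative of $\beta$ with $p^m$. *)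

theory Defs
  imports
    Complex_Main
    "Jordan_Normal_Form.Matrix"
    "Berlekamp_Zassenhaus.Finite_Field"
begin

(* The ring Z/nZ is the type 'a mod_ring with CARD('a) = n; the type class nontriv
   says CARD('a) > 1, which holds for every prime power p^m with m >= 1. *)

definition GL :: "nat \<Rightarrow> 'a :: comm_ring_1 mat set" where
  "GL r = {X \<in> carrier_mat r r. invertible_mat X}"

definition mat_trace :: "'a :: comm_ring_1 mat \<Rightarrow> 'a" where
  "mat_trace X = (\<Sum>i<dim_row X. X $$ (i, i))"

end

theory Submission
  imports Defs "Jordan_Normal_Form.Determinant"
begin

text \<open>In a finite local ring with \<open>n\<close> elements and set \<open>M\<close> of nonunits, \<open>N = |M|\<close>, classify the
  invertible matrices of size \<open>r + 1\<close> by their first column \<open>(a, v)\<close>.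
  If some entry of \<open>v\<close> is a unit, adding multiples of the first column to another column shows
  that all traces are equally likely. Otherwise \<open>a\<close> is a unit, the matrix is determined by its first
  row and an invertible Schur complement \<open>S\<close> of size \<open>r\<close>, and the trace is \<open>a + tr S\<close> up to a
  nonunit. By induction the number of invertible matrices of trace \<open>\<beta>\<close> depends only on whether \<open>\<beta>\<close> is a unit, and
  the difference \<open>d\<^sub>r\<close> of the two values satisfies \<open>d\<^sub>1 = -1\<close>,
  \<open>d\<^bsub>r+1\<^esub> = - N\<^bsup>r+1\<^esup> n\<^bsup>r\<^esup> d\<^sub>r\<close>. Together with the order of \<open>GL\<^sub>r\<close> this determines both values.\<close>

section \<open>Finite matrix sets\<close>

lemma card_eq_sum_card_fibres:
  assumes "finite A" "finite B" "f ` A \<subseteq> B"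
  shows "card A = (\<Sum>y\<in>B. card {x \<in> A. f x = y})"
proof -
  have "(\<Sum>y\<in>B. card {x \<in> A. f x = y}) = (\<Sum>y\<in>B. \<Sum>x | x \<in> A \<and> f x = y. 1)"
    by simp
  also have "\<dots> = (\<Sum>x\<in>A. 1)"
    by (rule sum.group[OF assms])
  finally show ?thesis by simp
qed

lemma bij_betw_vec_PiE:
  "bij_betw (\<lambda>f. vec n f) ({..<n} \<rightarrow>\<^sub>E A) {v \<in> carrier_vec n. \<forall>i<n. v $ i \<in> A}"
proof (rule bij_betwI[where g = "\<lambda>v. restrict (($) v) {..<n}"])
  show "(\<lambda>f. vec n f) \<in> ({..<n} \<rightarrow>\<^sub>E A) \<rightarrow> {v \<in> carrier_vec n. \<forall>i<n. v $ i \<in> A}"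
    by (auto simp: PiE_def Pi_def)
  show "(\<lambda>v. restrict (($) v) {..<n}) \<in> {v \<in> carrier_vec n. \<forall>i<n. v $ i \<in> A} \<rightarrow> ({..<n} \<rightarrow>\<^sub>E A)"
    by auto
  show "restrict (($) (vec n f)) {..<n} = f" if "f \<in> {..<n} \<rightarrow>\<^sub>E A" for f
    using that by (auto simp: PiE_def extensional_def restrict_def)
  show "vec n (restrict (($) v) {..<n}) = v" if "v \<in> {v \<in> carrier_vec n. \<forall>i<n. v $ i \<in> A}" for v
    using that by (intro eq_vecI) auto
qed

lemma card_carrier_vec_subset:
  "card {v \<in> carrier_vec n. \<forall>i<n. v $ i \<in> A} = card A ^ n"
  using bij_betw_same_card[OF bij_betw_vec_PiE[of n A]] by (simp add: card_PiE)

lemma finite_carrier_vec: "finite (carrier_vec n :: 'a :: finite vec set)"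
  using bij_betw_finite[OF bij_betw_vec_PiE[of n "UNIV :: 'a set"]] by (simp add: finite_PiE)

lemma card_carrier_vec: "card (carrier_vec n :: 'a :: finite vec set) = CARD('a) ^ n"
  using card_carrier_vec_subset[of n "UNIV :: 'a set"] by simp

lemma finite_carrier_mat: "finite (carrier_mat m n :: 'a :: finite mat set)"
proof -
  have "carrier_mat m n \<subseteq> (\<lambda>f. mat m n f) ` (({..<m} \<times> {..<n}) \<rightarrow>\<^sub>E (UNIV :: 'a set))"
  proof
    fix X :: "'a mat" assume X: "X \<in> carrier_mat m n"
    have eq: "X = mat m n (restrict (($$) X) ({..<m} \<times> {..<n}))"
      using X by (intro eq_matI) auto
    show "X \<in> (\<lambda>f. mat m n f) ` (({..<m} \<times> {..<n}) \<rightarrow>\<^sub>E UNIV)"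
      by (rule image_eqI[where f = "mat m n", OF eq]) simp
  qed
  then show ?thesis
    by (rule finite_subset) (intro finite_imageI finite_PiE, auto)
qed

lemma finite_GL: "finite (GL r :: 'a :: {comm_ring_1, finite} mat set)"
  by (rule finite_subset[OF _ finite_carrier_mat[of r r]]) (auto simp: GL_def)

text \<open>Turns sums over first columns with a unit on top and nonunits below into double sums
  over \<open>a\<close> and \<open>v\<close>.\<close>

lemma vCons_image_Times:
  "(\<lambda>(a, v). vCons a v) ` (A \<times> {v \<in> carrier_vec r. \<forall>i<r. v $ i \<in> B})
   = {c \<in> carrier_vec (Suc r). c $ 0 \<in> A \<and> (\<forall>i. 0 < i \<and> i \<le> r \<longrightarrow> c $ i \<in> B)}" (is "?L = ?R")
proof
  show "?L \<subseteq> ?R"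
    by (auto simp: vec_index_vCons)
  show "?R \<subseteq> ?L"
  proof
    fix c assume c: "c \<in> ?R"
    then obtain a v where [simp]: "c = vCons a v" by (cases c) auto
    have "v $ i \<in> B" if "i < r" for i
      using c that by (auto dest!: spec[of _ "Suc i"])
    with c show "c \<in> ?L" by (auto intro!: image_eqI[of _ _ "(a, v)"])
  qed
qed

section \<open>Invertible matrices over commutative rings\<close>

lemma GL_carrier: "X \<in> GL n \<Longrightarrow> X \<in> carrier_mat n n"
  by (simp add: GL_def)

text \<open>One direction is multiplicativity of \<open>det\<close>; for the other, an inverse
  \<open>b\<close> of the determinant makes \<open>b \<cdot>\<^sub>m adj_mat X\<close> a two-sided
  inverse.\<close>

lemma GL_iff_det:
  "X \<in> GL n \<longleftrightarrow> X \<in> carrier_mat n n \<and> det X dvd 1"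
proof (cases "X \<in> carrier_mat n n")
  case X: True
  have "invertible_mat X \<longleftrightarrow> det X dvd 1"
  proof
    assume "invertible_mat X"
    then obtain B where B: "X * B = 1\<^sub>m n" "B * X = 1\<^sub>m (dim_row B)"
      using X by (auto simp: invertible_mat_def inverts_mat_def)
    \<comment> \<open>The definition of invertibility does not fix the shape of \<open>B\<close>; it
      is recovered from the column numbers of the two products.\<close>
    from X arg_cong[OF B(1), of dim_col] arg_cong[OF B(2), of dim_col]
    have "B \<in> carrier_mat n n" by (intro carrier_matI) auto
    with det_mult[OF X this] B(1) show "det X dvd 1"
      by (metis det_one dvd_def)
  next
    assume "det X dvd 1"
    then obtain b where b: "det X * b = 1" by (metis dvd_def)
    have A: "adj_mat X \<in> carrier_mat n n" by (rule adj_mat[OF X])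
    have "X * (b \<cdot>\<^sub>m adj_mat X) = 1\<^sub>m n" "(b \<cdot>\<^sub>m adj_mat X) * X = 1\<^sub>m n"
      using b adj_mat(2,3)[OF X] X A
      by (auto simp: mult_smult_distrib[OF X A] mult_smult_assoc_mat[OF A X] mult.commute)
    then show "invertible_mat X"
      using X A unfolding invertible_mat_def inverts_mat_def
      by (intro conjI exI[of _ "b \<cdot>\<^sub>m adj_mat X"]) auto
  qed
  with X show ?thesis by (simp add: GL_def)
qed (simp add: GL_def)

text \<open>The matrix with first column \<open>(a, a w)\<close> and first row \<open>(a, u)\<close>
  whose Schur complement with respect to \<open>a\<close> is \<open>S\<close>.\<close>

definition schur_mat :: "'a :: comm_ring_1 \<Rightarrow> 'a vec \<Rightarrow> 'a vec \<Rightarrow> 'a mat \<Rightarrow> 'a mat" where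
  "schur_mat a w u S = mat (Suc (dim_row S)) (Suc (dim_row S)) (\<lambda>(i, j).
     if i = 0 then (if j = 0 then a else u $ (j - 1))
     else if j = 0 then a * w $ (i - 1) else w $ (i - 1) * u $ (j - 1) + S $$ (i - 1, j - 1))"

text \<open>The matrix factors as a lower unitriangular one with \<open>w\<close> below the corner
  times a block upper triangular one with diagonal blocks \<open>a\<close> and \<open>S\<close>. The
  entries \<open>a * w\<close> in the first column make this work without dividing by
  \<open>a\<close>.\<close>

lemma det_schur_mat:
  assumes S: "S \<in> carrier_mat r r"
  shows "det (schur_mat a w u S) = a * det S"
proof -
  let ?A = "mat 1 1 (\<lambda>_. a)" and ?U = "mat 1 r (\<lambda>(_, j). u $ j)" and ?W = "mat r 1 (\<lambda>(i, _). w $ i)"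
  let ?L = "four_block_mat (1\<^sub>m 1) (0\<^sub>m 1 r) ?W (1\<^sub>m r)"
  let ?B = "four_block_mat ?A ?U (0\<^sub>m r 1) S"
  have carr: "?L \<in> carrier_mat (1 + r) (1 + r)" "?B \<in> carrier_mat (1 + r) (1 + r)"
    using S by (auto intro!: four_block_carrier_mat)
  have "?L * ?B = four_block_mat (1\<^sub>m 1 * ?A + 0\<^sub>m 1 r * 0\<^sub>m r 1) (1\<^sub>m 1 * ?U + 0\<^sub>m 1 r * S)
    (?W * ?A + 1\<^sub>m r * 0\<^sub>m r 1) (?W * ?U + 1\<^sub>m r * S)"
    using S by (intro mult_four_block_mat) auto
  also have "\<dots> = schur_mat a w u S"
    using S by (intro eq_matI) (auto simp: schur_mat_def scalar_prod_def mult.commute)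
  finally have "det (schur_mat a w u S) = det ?L * det ?B"
    using det_mult[OF carr] by simp
  moreover have "det ?B = a * det S"
    using S by (subst det_four_block_mat_lower_left_zero_col[of _ _ r]) (auto simp: det_single)
  moreover have "det ?L = prod_list (diag_mat ?L)"
    by (rule det_lower_triangular[OF _ carr(1)]) auto
  moreover have "diag_mat ?L = replicate (Suc r) 1"
    by (rule nth_equalityI) (auto simp: diag_mat_def simp del: upt_Suc replicate_Suc)
  ultimately show ?thesis by simp
qed

lemma trace_schur_mat:
  assumes S: "S \<in> carrier_mat r r" and u: "u \<in> carrier_vec r"
  shows "mat_trace (schur_mat a w u S) = a + w \<bullet> u + mat_trace S"
proof -
  have "mat_trace (schur_mat a w u S) = (\<Sum>i<Suc r. schur_mat a w u S $$ (i, i))"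
    using S by (simp add: mat_trace_def schur_mat_def)
  also have "\<dots> = a + (\<Sum>i<r. w $ i * u $ i + S $$ (i, i))"
    using S unfolding sum.lessThan_Suc_shift by (simp add: schur_mat_def)
  also have "\<dots> = a + w \<bullet> u + mat_trace S"
    using S u by (simp add: mat_trace_def scalar_prod_def sum.distrib atLeast0LessThan)
  finally show ?thesis .
qed

lemma unit_mult_iff:
  fixes a b :: "'a :: comm_ring_1"
  shows "a * b dvd 1 \<longleftrightarrow> a dvd 1 \<and> b dvd 1"
  using mult_dvd_mono[of a 1 b 1] by (auto dest: dvd_mult_left dvd_mult_right)

text \<open>Since \<open>b\<close> inverts \<open>a\<close>, the column \<open>vCons a v\<close>
  fits \<open>schur_mat\<close> with \<open>w\<close> equal to \<open>b\<close> times
  \<open>v\<close>. The first row gives \<open>u\<close>, subtracting the outer product of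
  \<open>w\<close> and \<open>u\<close> gives \<open>S\<close>, and the formulas for determinant and
  trace carry both conditions over to \<open>S\<close>.\<close>

lemma bij_betw_schur_mat:
  assumes ab: "a * b = (1 :: 'a :: comm_ring_1)" and v: "v \<in> carrier_vec r"
  shows "bij_betw (\<lambda>(u, S). schur_mat a (b \<cdot>\<^sub>v v) u S)
    (SIGMA u:carrier_vec r. {S \<in> GL r. mat_trace S = \<beta> - a - b * (v \<bullet> u)})
    {X \<in> GL (Suc r). col X 0 = vCons a v \<and> mat_trace X = \<beta>}"
proof -
  let ?f = "\<lambda>(u, S). schur_mat a (b \<cdot>\<^sub>v v) u S"
  let ?g = "\<lambda>X. (vec r (\<lambda>j. X $$ (0, Suc j)),
    mat r r (\<lambda>(i, j). X $$ (Suc i, Suc j) - b * v $ i * X $$ (0, Suc j)))"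
  have abx: "a * (b * x) = x" for x
    using ab by (simp flip: mult.assoc)
  have a: "a dvd 1" using ab by (metis dvd_triv_left)
  have scalar: "(b \<cdot>\<^sub>v v) \<bullet> u = b * (v \<bullet> u)" if "u \<in> carrier_vec r" for u
    using v that by simp
  have mem: "schur_mat a (b \<cdot>\<^sub>v v) u S \<in> GL (Suc r) \<longleftrightarrow> S \<in> GL r"
    if "S \<in> carrier_mat r r" for u S
    using that a by (simp add: GL_iff_det det_schur_mat unit_mult_iff) (simp add: schur_mat_def)
  have tr: "mat_trace (schur_mat a (b \<cdot>\<^sub>v v) u S) = \<beta> \<longleftrightarrow> mat_trace S = \<beta> - a - b * (v \<bullet> u)"
    if "S \<in> carrier_mat r r" "u \<in> carrier_vec r" for u S
    using that by (auto simp: trace_schur_mat scalar algebra_simps)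
  have col: "col (schur_mat a (b \<cdot>\<^sub>v v) u S) 0 = vCons a v" if "S \<in> carrier_mat r r" for u S
    using that v by (intro eq_vecI) (auto simp: schur_mat_def vec_index_vCons abx)
  have carr: "S \<in> carrier_mat r r" if "S \<in> GL r" for S :: "'a mat" and r
    using that by (simp add: GL_def)
  have fg: "?f (?g X) = X" if "X \<in> carrier_mat (Suc r) (Suc r)" "col X 0 = vCons a v" for X
  proof (rule eq_matI)
    have X0: "X $$ (i, 0) = vCons a v $ i" if "i < Suc r" for i
      using that \<open>X \<in> _\<close> index_col[of i X 0] by (simp add: \<open>col X 0 = _\<close>)
    show "?f (?g X) $$ (i, j) = X $$ (i, j)" if "i < dim_row X" "j < dim_col X" for i j
      using that \<open>X \<in> _\<close> v by (cases i; cases j) (auto simp: schur_mat_def X0 abx)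
  qed (use that in \<open>auto simp: schur_mat_def\<close>)
  show ?thesis
  proof (rule bij_betwI[where g = ?g])
    show "?f \<in> (SIGMA u:carrier_vec r. {S \<in> GL r. mat_trace S = \<beta> - a - b * (v \<bullet> u)})
        \<rightarrow> {X \<in> GL (Suc r). col X 0 = vCons a v \<and> mat_trace X = \<beta>}"
      using mem tr col carr by auto
    show "?g \<in> {X \<in> GL (Suc r). col X 0 = vCons a v \<and> mat_trace X = \<beta>}
        \<rightarrow> (SIGMA u:carrier_vec r. {S \<in> GL r. mat_trace S = \<beta> - a - b * (v \<bullet> u)})"
    proof
      fix X assume X: "X \<in> {X \<in> GL (Suc r). col X 0 = vCons a v \<and> mat_trace X = \<beta>}"
      \<comment> \<open>The matrix rebuilt from \<open>?g X\<close> is \<open>X\<close>, so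
        \<open>mem\<close> and \<open>tr\<close>, read from left to right, give invertibility and
        trace of the Schur complement.\<close>
      then have *: "?f (?g X) = X" using fg carr by blast
      have u: "fst (?g X) \<in> carrier_vec r" and S: "snd (?g X) \<in> carrier_mat r r" by auto
      have "?f (?g X) \<in> GL (Suc r)" "mat_trace (?f (?g X)) = \<beta>"
        unfolding * using X by auto
      then show "?g X \<in> (SIGMA u:carrier_vec r. {S \<in> GL r. mat_trace S = \<beta> - a - b * (v \<bullet> u)})"
        using mem[OF S, of "fst (?g X)"] tr[OF S u] u by auto
    qed
    show "?f (?g X) = X" if "X \<in> {X \<in> GL (Suc r). col X 0 = vCons a v \<and> mat_trace X = \<beta>}" for X
      using that fg carr by blast
    show "?g (?f p) = p"
      if p: "p \<in> (SIGMA u:carrier_vec r. {S \<in> GL r. mat_trace S = \<beta> - a - b * (v \<bullet> u)})" for p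
    proof -
      obtain u S where p': "p = (u, S)" by force
      with p have "u \<in> carrier_vec r" "S \<in> carrier_mat r r" using carr by auto
      then show ?thesis
        unfolding p' using v by (auto intro!: eq_vecI eq_matI simp: schur_mat_def)
    qed
  qed
qed

section \<open>Counting over a finite local ring\<close>

text \<open>Closure of the nonunits under addition is the elementwise form of being local;
  \<open>M\<close> is then the maximal ideal.\<close>

locale finite_local_ring =
  fixes M :: "'a :: {comm_ring_1, finite} set"
  assumes mem_M_iff: "x \<in> M \<longleftrightarrow> \<not> x dvd 1"
    and add_M: "x \<in> M \<Longrightarrow> y \<in> M \<Longrightarrow> x + y \<in> M"
begin

definition trace_count :: "nat \<Rightarrow> 'a \<Rightarrow> nat" where
  "trace_count r \<beta> = card {X \<in> GL r. mat_trace X = \<beta>}"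

definition col_trace_count :: "'a vec \<Rightarrow> 'a \<Rightarrow> nat" where
  "col_trace_count c \<beta> = card {X \<in> GL (dim_vec c). col X 0 = c \<and> mat_trace X = \<beta>}"

definition col_count :: "'a vec \<Rightarrow> nat" where
  "col_count c = card {X \<in> GL (dim_vec c). col X 0 = c}"

section \<open>Arithmetic of the nonunits\<close>

lemma mult_M: "x \<in> M \<Longrightarrow> x * y \<in> M"
  by (auto simp: mem_M_iff dest: dvd_mult_left)

lemma zero_M: "0 \<in> M"
  by (simp add: mem_M_iff)

lemma sum_M: "(\<And>i. i \<in> A \<Longrightarrow> f i \<in> M) \<Longrightarrow> sum f A \<in> M"
  by (induction A rule: infinite_finite_induct) (auto simp: zero_M add_M)

lemma diff_M: "x \<in> M \<Longrightarrow> y \<in> M \<Longrightarrow> x - y \<in> M"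
  using add_M[of x "- y"] mult_M[of y "- 1"] by simp

lemma add_M_iff: "y \<in> M \<Longrightarrow> x + y \<in> M \<longleftrightarrow> x \<in> M"
  using add_M[of x y] diff_M[of "x + y" y] by auto

lemma not_M_obtain:
  assumes "a \<notin> M" obtains b where "a * b = 1"
  using assms by (metis mem_M_iff dvd_def)

section \<open>Counting by the first column\<close>

lemma trace_count_Suc: "trace_count (Suc r) \<beta> = (\<Sum>c\<in>carrier_vec (Suc r). col_trace_count c \<beta>)"
proof -
  have "col X 0 \<in> carrier_vec (Suc r)" if "X \<in> GL (Suc r)" for X :: "'a mat"
    using GL_carrier[OF that] by (simp add: carrier_vecI)
  then show ?thesis
    unfolding trace_count_def col_trace_count_def
    by (subst card_eq_sum_card_fibres[where f = "\<lambda>X. col X 0", OF _ finite_carrier_vec])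
      (auto simp: finite_GL intro!: sum.cong arg_cong[of _ _ card])
qed

lemma sum_trace_count: "(\<Sum>\<beta>\<in>UNIV. trace_count r \<beta>) = card (GL r :: 'a mat set)"
  unfolding trace_count_def
  by (subst card_eq_sum_card_fibres[where f = mat_trace and B = UNIV]) (auto simp: finite_GL)

lemma sum_col_trace_count: "(\<Sum>\<beta>\<in>UNIV. col_trace_count c \<beta>) = col_count c"
  unfolding col_trace_count_def col_count_def
  by (subst card_eq_sum_card_fibres[where f = mat_trace and B = UNIV])
    (auto simp: finite_GL conj_assoc)

lemma sum_col_count: "card (GL (Suc r) :: 'a mat set) = (\<Sum>c\<in>carrier_vec (Suc r). col_count c)"
  unfolding sum_trace_count[symmetric] sum_col_trace_count[symmetric] trace_count_Suc
  by (rule sum.swap)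

lemma col_trace_count_vCons:
  assumes ab: "a * b = 1" and v: "v \<in> carrier_vec r"
  shows "col_trace_count (vCons a v) \<beta> = (\<Sum>u\<in>carrier_vec r. trace_count r (\<beta> - a - b * (v \<bullet> u)))"
  using bij_betw_same_card[OF bij_betw_schur_mat[OF ab v, of \<beta>]] v
  by (simp add: col_trace_count_def trace_count_def finite_carrier_vec finite_GL)

text \<open>For fixed \<open>u\<close> the trace prescribed for the Schur complement runs through
  the whole ring as \<beta> does, so each row \<open>u\<close> contributes all of
  \<open>GL r\<close>.\<close>

lemma col_count_vCons_unit:
  assumes a: "a \<notin> M" and v: "v \<in> carrier_vec r"
  shows "col_count (vCons a v) = CARD('a) ^ r * card (GL r :: 'a mat set)"
proof -
  obtain b where ab: "a * b = 1" using a by (rule not_M_obtain)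
  have "(\<Sum>\<beta>\<in>UNIV. trace_count r (\<beta> - x)) = card (GL r :: 'a mat set)" for x
    unfolding sum_trace_count[symmetric]
    by (rule sum.reindex_bij_witness[where i = "\<lambda>\<beta>. \<beta> + x" and j = "\<lambda>\<beta>. \<beta> - x"]) auto
  from this[of "a + b * (v \<bullet> u)" for u] show ?thesis
    unfolding sum_col_trace_count[symmetric] col_trace_count_vCons[OF ab v]
    by (subst sum.swap) (simp add: diff_diff_eq card_carrier_vec)
qed

text \<open>Adding a multiple of the first column to column \<open>i\<close> shifts the trace by an arbitrary amount.\<close>

lemma col_trace_count_equidistributed:
  assumes c: "c \<in> carrier_vec (Suc r)" and i: "0 < i" "i \<le> r" "c $ i \<notin> M"
  shows "col_trace_count c \<beta> = col_trace_count c \<beta>'"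
proof -
  obtain b where b: "c $ i * b = 1" using i(3) by (rule not_M_obtain)
  let ?S = "\<lambda>\<beta>. {X \<in> GL (Suc r). col X 0 = c \<and> mat_trace X = \<beta>}"
  have tr: "mat_trace (addcol k i 0 X) = mat_trace X + k * c $ i"
    if X: "X \<in> carrier_mat (Suc r) (Suc r)" "col X 0 = c" for k X
  proof -
    have "X $$ (i, 0) = c $ i" using X i index_col[of i X 0] by simp
    then have "mat_trace (addcol k i 0 X) = (\<Sum>j<Suc r. X $$ (j, j) + (if j = i then k * c $ i else 0))"
      unfolding mat_trace_def using X by (intro sum.cong) auto
    also have "\<dots> = mat_trace X + k * c $ i"
      unfolding sum.distrib using X i by (simp add: mat_trace_def)
    finally show ?thesis .
  qed
  \<comment> \<open>As \<open>b\<close> inverts \<open>c $ i\<close>, this multiplier moves the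
    trace by exactly \<open>\<beta>2 - \<beta>1\<close>; column 0 stays fixed because
    \<open>i\<close> is positive.\<close>
  have mem: "addcol ((\<beta>2 - \<beta>1) * b) i 0 X \<in> ?S \<beta>2" if "X \<in> ?S \<beta>1" for X \<beta>1 \<beta>2
  proof -
    have X: "X \<in> carrier_mat (Suc r) (Suc r)" "col X 0 = c" using that by (auto simp: GL_def)
    have "col (addcol ((\<beta>2 - \<beta>1) * b) i 0 X) 0 = c"
      using X i by (auto intro!: eq_vecI)
    moreover have "(\<beta>2 - \<beta>1) * b * c $ i = \<beta>2 - \<beta>1"
      using b by (metis mult.assoc mult.commute mult.right_neutral)
    moreover have "addcol ((\<beta>2 - \<beta>1) * b) i 0 X \<in> carrier_mat (Suc r) (Suc r)"
      using X by (intro carrier_matI) auto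
    ultimately show ?thesis
      using that tr[OF X] X i by (simp add: GL_iff_det det_addcol[of _ "Suc r"])
  qed
  have inv: "addcol ((\<beta>1 - \<beta>2) * b) i 0 (addcol ((\<beta>2 - \<beta>1) * b) i 0 X) = X"
    if "X \<in> ?S \<beta>1" for X \<beta>1 \<beta>2
    using that i by (intro eq_matI) (auto simp: GL_def algebra_simps)
  have "bij_betw (addcol ((\<beta>' - \<beta>) * b) i 0) (?S \<beta>) (?S \<beta>')"
    by (rule bij_betwI[where g = "addcol ((\<beta> - \<beta>') * b) i 0"]) (use mem inv in blast)+
  from bij_betw_same_card[OF this] show ?thesis
    using c by (simp add: col_trace_count_def)
qed

text \<open>Adding row \<open>Suc i\<close> to row 0 is an invertible operation that changes the
  first column only at the top. It serves to bring a unit there.\<close>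

lemma col_count_vCons_add:
  assumes v: "v \<in> carrier_vec r" and i: "i < r"
  shows "col_count (vCons a v) = col_count (vCons (a + v $ i) v)"
proof -
  let ?S = "\<lambda>a. {X \<in> GL (Suc r). col X 0 = vCons a v}"
  have mem: "addrow k 0 (Suc i) X \<in> ?S (a + k * v $ i)" if "X \<in> ?S a" for a k X
  proof -
    have X: "X \<in> carrier_mat (Suc r) (Suc r)" "col X 0 = vCons a v" using that by (auto simp: GL_def)
    have X0: "X $$ (i, 0) = vCons a v $ i" if "i < Suc r" for i
      using that X index_col[of i X 0] by simp
    have "col (addrow k 0 (Suc i) X) 0 = vCons (a + k * v $ i) v"
      using X i v by (intro eq_vecI) (auto simp: X0 vec_index_vCons)
    then show ?thesis
      using that X i by (simp add: GL_iff_det det_addrow[of _ "Suc r"])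
  qed
  have inv: "addrow (- k) 0 (Suc i) (addrow k 0 (Suc i) X) = X" if "X \<in> ?S a" for a k X
    using that i by (intro eq_matI) (auto simp: GL_def algebra_simps)
  have "bij_betw (addrow 1 0 (Suc i)) (?S a) (?S (a + v $ i))"
  proof (rule bij_betwI[where g = "addrow (- 1) 0 (Suc i)"])
    show "addrow 1 0 (Suc i) \<in> ?S a \<rightarrow> ?S (a + v $ i)"
      using mem[of _ a 1] by auto
    show "addrow (- 1) 0 (Suc i) \<in> ?S (a + v $ i) \<rightarrow> ?S a"
      using mem[of _ "a + v $ i" "- 1"] by auto
    show "addrow (- 1) 0 (Suc i) (addrow 1 0 (Suc i) X) = X" if "X \<in> ?S a" for X
      using inv[OF that] .
    show "addrow 1 0 (Suc i) (addrow (- 1) 0 (Suc i) X) = X" if "X \<in> ?S (a + v $ i)" for X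
      using inv[OF that, of "- 1"] by simp
  qed
  from bij_betw_same_card[OF this] show ?thesis
    using v by (simp add: col_count_def)
qed

text \<open>Laplace expansion along the first column makes the determinant a sum of multiples of
  nonunits.\<close>

lemma col_count_nonunits:
  assumes "c \<in> carrier_vec (Suc r)" "\<forall>i<Suc r. c $ i \<in> M"
  shows "col_count c = 0"
proof -
  have False if X: "X \<in> GL (Suc r)" "col X 0 = c" for X
  proof -
    have XM: "X \<in> carrier_mat (Suc r) (Suc r)" using X by (simp add: GL_def)
    then have "X $$ (i, 0) \<in> M" if "i < Suc r" for i
      using that X assms index_col[of i X 0] by (metis carrier_matD zero_less_Suc)
    then have "det X \<in> M"
      unfolding laplace_expansion_column[OF XM zero_less_Suc] by (intro sum_M mult_M) simp
    then show False using X by (simp add: GL_iff_det mem_M_iff)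
  qed
  then have "{X \<in> GL (Suc r). col X 0 = c} = {}" by blast
  then show ?thesis by (simp only: col_count_def carrier_vecD[OF assms(1)] card.empty)
qed

text \<open>If the top entry is a nonunit, adding a lower unit entry to it gives a unit, which
  reduces the claim to columns with a unit on top.\<close>

lemma col_count_unimodular:
  assumes c: "c \<in> carrier_vec (Suc r)" and i: "i < Suc r" "c $ i \<notin> M"
  shows "col_count c = CARD('a) ^ r * card (GL r :: 'a mat set)"
proof -
  obtain a v where c': "c = vCons a v" and v: "v \<in> carrier_vec r" using c by (cases c) auto
  show ?thesis
  proof (cases "a \<in> M")
    case True
    then obtain j where j: "i = Suc j" using i c' by (cases i) auto
    with i c' True have "j < r" "a + v $ j \<notin> M"
      using add_M_iff[of a "v $ j"] by (auto simp: add.commute)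
    then show ?thesis
      using col_count_vCons_add[OF v, of j a] col_count_vCons_unit[OF _ v] by (simp add: c')
  qed (simp add: c' v col_count_vCons_unit)
qed

text \<open>Columns over \<open>M\<close> belong to no invertible matrix, and each of the remaining
  columns belongs to equally many.\<close>

lemma card_GL_Suc:
  "card (GL (Suc r) :: 'a mat set)
   = (CARD('a) ^ Suc r - card M ^ Suc r) * CARD('a) ^ r * card (GL r :: 'a mat set)"
proof -
  let ?N = "{c \<in> carrier_vec (Suc r). \<forall>i<Suc r. c $ i \<in> M}"
  have "card (GL (Suc r) :: 'a mat set) = (\<Sum>c\<in>carrier_vec (Suc r) - ?N. col_count c)"
    unfolding sum_col_count
    by (rule sum.mono_neutral_right) (auto simp: finite_carrier_vec col_count_nonunits)
  also have "\<dots> = (\<Sum>c\<in>carrier_vec (Suc r) - ?N. CARD('a) ^ r * card (GL r :: 'a mat set))"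
    by (rule sum.cong) (auto simp: col_count_unimodular)
  also have "\<dots> = card (carrier_vec (Suc r) - ?N) * (CARD('a) ^ r * card (GL r :: 'a mat set))"
    by simp
  also have "card (carrier_vec (Suc r) - ?N) = CARD('a) ^ Suc r - card M ^ Suc r"
    using card_Diff_subset[of ?N "carrier_vec (Suc r)"] finite_carrier_vec[where 'a = 'a]
    by (simp add: card_carrier_vec_subset card_carrier_vec finite_subset[of ?N "carrier_vec (Suc r)"]
        del: power_Suc)
  finally show ?thesis by (simp only: mult.assoc)
qed

lemma card_GL:
  "card (GL r :: 'a mat set) = (\<Prod>k=1..r. (CARD('a) ^ k - card M ^ k) * CARD('a) ^ (k - 1))"
proof (induction r)
  case 0
  have "GL 0 = {1\<^sub>m 0 :: 'a mat}"
    by (auto simp: GL_iff_det intro!: eq_matI)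
  then show ?case by simp
next
  case (Suc r)
  then show ?case by (simp add: card_GL_Suc prod.nat_ivl_Suc' del: power_Suc)
qed

text \<open>Columns with a unit below the top cancel by equidistribution, and columns of nonunits
  contribute nothing. What remains is a unit \<open>a\<close> above one of the
  \<open>card M ^ r\<close> vectors over \<open>M\<close>. The invariance \<open>shift\<close> is a
  premise so that the formula can serve in the induction that proves this invariance.\<close>

lemma trace_count_Suc_diff:
  assumes shift: "\<And>x y. y \<in> M \<Longrightarrow> trace_count r (x + y) = trace_count r x"
  shows "int (trace_count (Suc r) \<beta>) - int (trace_count (Suc r) \<beta>') = int (card M ^ r * CARD('a) ^ r)
    * (\<Sum>a\<in>- M. int (trace_count r (\<beta> - a)) - int (trace_count r (\<beta>' - a)))"
proof -
  let ?V = "{v \<in> carrier_vec r. \<forall>i<r. v $ i \<in> M}"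
  let ?C = "{c \<in> carrier_vec (Suc r). c $ 0 \<in> - M \<and> (\<forall>i. 0 < i \<and> i \<le> r \<longrightarrow> c $ i \<in> M)}"
  let ?D = "\<lambda>c. int (col_trace_count c \<beta>) - int (col_trace_count c \<beta>')"
  \<comment> \<open>The Schur complement has trace \<open>\<beta> - a\<close> up to a multiple of
    \<open>v \<bullet> u\<close>, a nonunit that \<open>shift\<close> removes; so all rows
    \<open>u\<close> contribute equally.\<close>
  have block: "col_trace_count (vCons a v) \<beta> = CARD('a) ^ r * trace_count r (\<beta> - a)"
    if a: "a \<notin> M" and v: "v \<in> ?V" for a v \<beta>
  proof -
    obtain b where ab: "a * b = 1" using a by (rule not_M_obtain)
    have "- (b * (v \<bullet> u)) \<in> M" if "u \<in> carrier_vec r" for u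
    proof -
      have "v \<bullet> u \<in> M" using v that by (auto simp: scalar_prod_def intro!: sum_M mult_M)
      from mult_M[OF this, of "- b"] show ?thesis by (simp add: mult.commute)
    qed
    from shift[OF this, of _ "\<beta> - a"] show ?thesis
      using v by (simp add: col_trace_count_vCons[OF ab, of v r] card_carrier_vec)
  qed
  have zero: "?D c = 0" if c: "c \<in> carrier_vec (Suc r) - ?C" for c
  proof (cases "\<exists>i. 0 < i \<and> i \<le> r \<and> c $ i \<notin> M")
    case True
    with c show ?thesis using col_trace_count_equidistributed[of c r _ \<beta> \<beta>'] by auto
  next
    case False
    with c have "c $ i \<in> M" if "i < Suc r" for i
      using that by (cases "i = 0") (auto simp: less_Suc_eq_le)
    with c have "(\<Sum>\<beta>\<in>UNIV. col_trace_count c \<beta>) = 0"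
      unfolding sum_col_trace_count by (intro col_count_nonunits) auto
    then show ?thesis by simp
  qed
  have "int (trace_count (Suc r) \<beta>) - int (trace_count (Suc r) \<beta>') = (\<Sum>c\<in>carrier_vec (Suc r). ?D c)"
    by (simp add: trace_count_Suc sum_subtractf)
  also have "\<dots> = (\<Sum>c\<in>?C. ?D c)"
    using zero by (intro sum.mono_neutral_right) (auto simp: finite_carrier_vec)
  also have "\<dots> = (\<Sum>(a, v)\<in>(- M) \<times> ?V. ?D (vCons a v))"
    unfolding vCons_image_Times[symmetric]
    by (subst sum.reindex) (auto simp: inj_on_def intro!: sum.cong)
  also have "\<dots> = (\<Sum>(a, v)\<in>(- M) \<times> ?V.
      int (CARD('a) ^ r) * (int (trace_count r (\<beta> - a)) - int (trace_count r (\<beta>' - a))))"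
    by (intro sum.cong) (auto simp: block algebra_simps)
  also have "\<dots> = (\<Sum>a\<in>- M. \<Sum>v\<in>?V.
      int (CARD('a) ^ r) * (int (trace_count r (\<beta> - a)) - int (trace_count r (\<beta>' - a))))"
    by (rule sum.cartesian_product[symmetric])
  also have "\<dots> = int (card M ^ r * CARD('a) ^ r)
    * (\<Sum>a\<in>- M. int (trace_count r (\<beta> - a)) - int (trace_count r (\<beta>' - a)))"
    by (simp add: card_carrier_vec_subset sum_distrib_left mult.assoc)
  finally show ?thesis .
qed

section \<open>Solving the recursion in the matrix size\<close>

lemma trace_count_1: "trace_count 1 \<beta> = (if \<beta> \<in> M then 0 else 1)"
proof -
  have "{X \<in> GL 1. mat_trace X = \<beta>} = (if \<beta> \<in> M then {} else {mat 1 1 (\<lambda>_. \<beta>)})"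
    by (auto simp: GL_iff_det det_single mat_trace_def mem_M_iff intro!: eq_matI)
  then show ?thesis by (simp add: trace_count_def)
qed

text \<open>In the difference formula for \<open>x + y\<close> and \<open>x\<close> every summand
  vanishes by the induction hypothesis. The induction starts at size 1, because in size 0 only the
  trace 0 occurs while \<open>M\<close> may contain more than 0.\<close>

lemma trace_count_shift:
  assumes "1 \<le> r" "y \<in> M"
  shows "trace_count r (x + y) = trace_count r x"
  using assms
proof (induction r arbitrary: x y rule: nat_induct_at_least)
  case base
  then show ?case unfolding trace_count_1 by (simp add: add_M_iff)
next
  case (Suc r)
  have "trace_count r (x + y - a) = trace_count r (x - a)" for a
    using Suc.IH[OF Suc.prems, of "x - a"] by (simp add: algebra_simps)
  with trace_count_Suc_diff[OF Suc.IH, of "x + y" x] show ?case by simp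
qed

text \<open>In the sum over units \<open>a\<close>, the element \<open>\<beta> - a\<close> is always
  a unit, while \<open>\<beta>' - a\<close> is a nonunit exactly \<open>card M\<close> times; this
  gives the recursion. The factor \<open>card M\<close> on the left turns the initial value -1 into
  the factor for \<open>k = 1\<close>, so that the solution is a plain product.\<close>

lemma trace_count_nonunit_diff_unit:
  assumes "1 \<le> r" "\<beta> \<in> M" "\<beta>' \<notin> M"
  shows "int (card M) * (int (trace_count r \<beta>) - int (trace_count r \<beta>'))
    = (\<Prod>k=1..r. - (int (card M) ^ k * int CARD('a) ^ (k - 1)))"
  using assms
proof (induction r arbitrary: \<beta> \<beta>' rule: nat_induct_at_least)
  case base
  then show ?case unfolding trace_count_1 by simp
next
  case (Suc r)
  let ?F = "\<lambda>\<beta>. int (trace_count r \<beta>)"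
  \<comment> \<open>The product in the induction hypothesis is the same for every unit, so all units
    have equal counts.\<close>
  have eq: "trace_count r x = trace_count r \<beta>'" if "x \<notin> M" for x
  proof -
    have "int (card M) * (?F 0 - ?F x) = int (card M) * (?F 0 - ?F \<beta>')"
      using Suc.IH[OF zero_M that] Suc.IH[OF zero_M \<open>\<beta>' \<notin> M\<close>] by simp
    moreover have "card M \<noteq> 0" using zero_M by auto
    ultimately show ?thesis by simp
  qed
  have eq0: "trace_count r x = trace_count r \<beta>" if "x \<in> M" for x
    using trace_count_shift[OF Suc.hyps that, of 0] trace_count_shift[OF Suc.hyps \<open>\<beta> \<in> M\<close>, of 0]
    by simp
  have "?F (\<beta> - a) - ?F (\<beta>' - a) = (if \<beta>' - a \<in> M then ?F \<beta>' - ?F \<beta> else 0)" if "a \<in> - M" for a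
  proof -
    \<comment> \<open>Otherwise \<open>a = \<beta> - (\<beta> - a)\<close> would be a
      nonunit.\<close>
    have "\<beta> - a \<notin> M" using diff_M[OF \<open>\<beta> \<in> M\<close>, of "\<beta> - a"] that by auto
    then show ?thesis using eq[of "\<beta> - a"] eq[of "\<beta>' - a"] eq0[of "\<beta>' - a"] by auto
  qed
  then have "(\<Sum>a\<in>- M. ?F (\<beta> - a) - ?F (\<beta>' - a)) = (\<Sum>a\<in>- M. if \<beta>' - a \<in> M then ?F \<beta>' - ?F \<beta> else 0)"
    by (rule sum.cong[OF refl])
  also have "\<dots> = int (card {a \<in> - M. \<beta>' - a \<in> M}) * (?F \<beta>' - ?F \<beta>)"
    by (subst sum.inter_filter[symmetric]) auto
  \<comment> \<open>Each \<open>\<beta>' - y\<close> with \<open>y\<close> in \<open>M\<close> is a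
    unit, since otherwise \<beta>' would lie in \<open>M\<close>.\<close>
  also have "{a \<in> - M. \<beta>' - a \<in> M} = (\<lambda>y. \<beta>' - y) ` M"
  proof
    show "{a \<in> - M. \<beta>' - a \<in> M} \<subseteq> (\<lambda>y. \<beta>' - y) ` M"
      by (auto intro!: image_eqI[of a _ "\<beta>' - a" for a])
    show "(\<lambda>y. \<beta>' - y) ` M \<subseteq> {a \<in> - M. \<beta>' - a \<in> M}"
      using add_M[of "\<beta>' - y" y for y] \<open>\<beta>' \<notin> M\<close> by auto
  qed
  also have "card ((\<lambda>y. \<beta>' - y) ` M) = card M"
    by (rule card_image) (auto simp: inj_on_def)
  finally have "int (trace_count (Suc r) \<beta>) - int (trace_count (Suc r) \<beta>')
      = int (card M ^ r * CARD('a) ^ r) * (int (card M) * (?F \<beta>' - ?F \<beta>))"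
    by (subst trace_count_Suc_diff[OF trace_count_shift[OF Suc.hyps]]) simp_all
  then have "int (card M) * (int (trace_count (Suc r) \<beta>) - int (trace_count (Suc r) \<beta>'))
      = int (card M) * (int (card M ^ r * CARD('a) ^ r) * (int (card M) * (?F \<beta>' - ?F \<beta>)))"
    by (rule arg_cong)
  also have "\<dots> = - (int (card M) ^ Suc r * int CARD('a) ^ r) * (int (card M) * (?F \<beta> - ?F \<beta>'))"
    by (simp add: algebra_simps)
  also have "int (card M) * (?F \<beta> - ?F \<beta>') = (\<Prod>k=1..r. - (int (card M) ^ k * int CARD('a) ^ (k - 1)))"
    by (rule Suc.IH[OF Suc.prems])
  finally show ?case by (simp add: prod.nat_ivl_Suc' del: power_Suc)
qed

text \<open>The sum of the counts over all traces is \<open>CARD('a)\<close> times the value at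
  units plus \<open>card M\<close> times the difference between nonunits and units; the second term
  is the product already known.\<close>

lemma trace_count_unit:
  assumes r: "1 \<le> r" and \<beta>: "\<beta> \<notin> M"
  shows "int CARD('a) * int (trace_count r \<beta>)
    = int (card (GL r :: 'a mat set)) - (\<Prod>k=1..r. - (int (card M) ^ k * int CARD('a) ^ (k - 1)))"
proof -
  have eq: "int (trace_count r x) = int (trace_count r \<beta>)
      + (if x \<in> M then int (trace_count r 0) - int (trace_count r \<beta>) else 0)" for x
  proof (cases "x \<in> M")
    case True
    then show ?thesis using trace_count_shift[OF r True, of 0] by simp
  next
    case False
    have "int (card M) * (int (trace_count r 0) - int (trace_count r x))
        = int (card M) * (int (trace_count r 0) - int (trace_count r \<beta>))"
      using trace_count_nonunit_diff_unit[OF r zero_M False]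
        trace_count_nonunit_diff_unit[OF r zero_M \<beta>] by (rule trans[OF _ sym])
    moreover have "card M \<noteq> 0" using zero_M by auto
    ultimately show ?thesis using False by simp
  qed
  have "int (card (GL r :: 'a mat set)) = (\<Sum>x\<in>UNIV. int (trace_count r \<beta>)
      + (if x \<in> M then int (trace_count r 0) - int (trace_count r \<beta>) else 0))"
    unfolding sum_trace_count[symmetric] of_nat_sum by (rule sum.cong[OF refl eq])
  also have "\<dots> = int CARD('a) * int (trace_count r \<beta>)
      + int (card M) * (int (trace_count r 0) - int (trace_count r \<beta>))"
    unfolding sum.distrib by (subst sum.inter_filter[symmetric]) auto
  finally show ?thesis
    unfolding trace_count_nonunit_diff_unit[OF r zero_M \<beta>] by simp
qed

end

section \<open>The integers modulo a prime power\<close>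

lemma of_int_mod_ring_eq_iff:
  "(of_int x :: 'a :: nontriv mod_ring) = of_int y \<longleftrightarrow> [x = y] (mod int CARD('a))"
  unfolding of_int_of_int_mod_ring cong_def by transfer simp

lemma mod_ring_of_int_obtain:
  obtains k where "0 \<le> k" "k < int CARD('a)" "(x :: 'a :: nontriv mod_ring) = of_int k"
  using range_to_int_mod_ring[where 'a = 'a] of_int_mod_ring_to_int_mod_ring[of x]
  by (metis atLeastLessThan_iff of_int_of_int_mod_ring rangeI)

lemma of_int_mod_ring_dvd_1_iff:
  "(of_int x :: 'a :: nontriv mod_ring) dvd 1 \<longleftrightarrow> coprime x (int CARD('a))"
proof -
  have "(of_int x :: 'a mod_ring) dvd 1 \<longleftrightarrow> (\<exists>y. of_int (x * y) = (of_int 1 :: 'a mod_ring))"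
    by (metis dvd_def mod_ring_of_int_obtain of_int_1 of_int_mult)
  then show ?thesis
    unfolding of_int_mod_ring_eq_iff coprime_iff_invertible_int .
qed

lemma of_int_mod_ring_prime_power_dvd_1_iff:
  assumes "prime p" "1 \<le> m" "CARD('a :: nontriv) = p ^ m"
  shows "(of_int x :: 'a mod_ring) dvd 1 \<longleftrightarrow> \<not> int p dvd x"
proof -
  have "coprime x (int p ^ m) \<longleftrightarrow> coprime (int p) x"
    using assms(2) by (simp add: coprime_power_right_iff coprime_commute)
  also have "\<dots> \<longleftrightarrow> \<not> int p dvd x"
  proof -
    have "prime (int p)" using assms(1) by simp
    then show ?thesis
      by (meson coprime_common_divisor dvd_refl not_prime_unit prime_imp_coprime)
  qed
  finally show ?thesis
    by (simp add: of_int_mod_ring_dvd_1_iff assms(3))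
qed

text \<open>The nonunits are the classes of multiples of \<open>p\<close>, which are closed under
  addition.\<close>

lemma finite_local_ring_mod_ring:
  assumes "prime p" "1 \<le> m" "CARD('a :: nontriv) = p ^ m"
  shows "finite_local_ring {x :: 'a mod_ring. \<not> x dvd 1}"
proof
  fix x y :: "'a mod_ring"
  assume "x \<in> {x. \<not> x dvd 1}" "y \<in> {x. \<not> x dvd 1}"
  moreover obtain k l where "x = of_int k" "y = of_int l" by (metis mod_ring_of_int_obtain)
  ultimately show "x + y \<in> {x. \<not> x dvd 1}"
    using of_int_mod_ring_prime_power_dvd_1_iff[OF assms]
    by (simp flip: of_int_add)
qed simp

text \<open>The multiples \<open>p * k\<close> with \<open>k\<close> from 0 to below
  \<open>p ^ (m - 1)\<close> represent each nonunit exactly once.\<close>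

lemma card_nonunits_mod_ring:
  assumes "prime p" "1 \<le> m" "CARD('a :: nontriv) = p ^ m"
  shows "card {x :: 'a mod_ring. \<not> x dvd 1} = p ^ (m - 1)"
proof -
  let ?f = "\<lambda>k. of_int (int p * k) :: 'a mod_ring"
  have p: "0 < int p" using assms(1) by (simp add: prime_gt_0_nat)
  have pm: "int p ^ m = int p * int p ^ (m - 1)"
    using assms(2) power_minus_mult[of m "int p"] by (simp add: mult.commute)
  have "{x :: 'a mod_ring. \<not> x dvd 1} = ?f ` {0..<int p ^ (m - 1)}"
  proof
    show "?f ` {0..<int p ^ (m - 1)} \<subseteq> {x. \<not> x dvd 1}"
      using of_int_mod_ring_prime_power_dvd_1_iff[OF assms, of "int p * k" for k]
      by (simp add: image_subset_iff del: of_int_mult)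
    show "{x :: 'a mod_ring. \<not> x dvd 1} \<subseteq> ?f ` {0..<int p ^ (m - 1)}"
    proof
      fix x :: "'a mod_ring" assume x: "x \<in> {x. \<not> x dvd 1}"
      obtain l where l: "0 \<le> l" "l < int CARD('a)" "x = of_int l" by (rule mod_ring_of_int_obtain)
      with x obtain k where k: "l = int p * k"
        using of_int_mod_ring_prime_power_dvd_1_iff[OF assms, of l] by (auto simp: dvd_def)
      with l p have "k \<in> {0..<int p ^ (m - 1)}"
        by (simp add: assms(3) pm zero_le_mult_iff)
      with l k show "x \<in> ?f ` {0..<int p ^ (m - 1)}" by blast
    qed
  qed
  moreover have "inj_on ?f {0..<int p ^ (m - 1)}"
  proof
    fix k l assume kl: "k \<in> {0..<int p ^ (m - 1)}" "l \<in> {0..<int p ^ (m - 1)}" "?f k = ?f l"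
    from kl(3) have "[int p * k = int p * l] (mod int p * int p ^ (m - 1))"
      unfolding of_int_mod_ring_eq_iff assms(3) of_nat_power pm .
    then have "[k = l] (mod int p ^ (m - 1))"
      using p by (simp add: cong_def mult_mod_right[symmetric])
    with kl show "k = l" by (simp add: cong_def)
  qed
  ultimately have "card {x :: 'a mod_ring. \<not> x dvd 1} = card {0..<int p ^ (m - 1)}"
    by (simp add: card_image)
  then show ?thesis by (simp add: nat_power_eq)
qed

section \<open>Closed forms of the two products over the reals\<close>

lemma prod_nonunit_powers:
  fixes p q :: real
  shows "(\<Prod>k=1..r. - ((q / p) ^ k * q ^ (k - 1)))
    = q ^ r\<^sup>2 * ((- 1) ^ r * p powi (- int (r * (r + 1) div 2)))"
proof (induction r)
  case (Suc r)
  \<comment> \<open>The exponents of \<open>1 / p\<close> add up to a triangular number; those of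
    \<open>q\<close> are the odd numbers \<open>k + (k - 1)\<close> and add up to a square.\<close>
  have T: "Suc r * (Suc r + 1) div 2 = r * (r + 1) div 2 + Suc r" by simp
  have sq: "(Suc r)\<^sup>2 = r\<^sup>2 + (Suc r + r)" by (simp add: power2_eq_square)
  have powi: "p powi (- int k) = inverse (p ^ k)" for k by (simp add: power_int_minus)
  have "(\<Prod>k=1..Suc r. - ((q / p) ^ k * q ^ (k - 1)))
      = - ((q / p) ^ Suc r * q ^ r) * (\<Prod>k=1..r. - ((q / p) ^ k * q ^ (k - 1)))"
    by (simp add: prod.nat_ivl_Suc')
  also have "\<dots> = q ^ (Suc r)\<^sup>2 * ((- 1) ^ Suc r * p powi (- int (Suc r * (Suc r + 1) div 2)))"
    unfolding Suc T sq powi by (simp add: power_add power_mult_distrib power_inverse divide_inverse)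
  finally show ?case .
qed simp

text \<open>Here \<open>q\<close> is the size of the ring and \<open>q / p\<close> the number of
  nonunits; \<open>q ^ k\<close> factors out of each bracket.\<close>

lemma prod_unimodular_counts:
  fixes p q :: real
  shows "(\<Prod>k=1..r. (q ^ k - (q / p) ^ k) * q ^ (k - 1)) = q ^ r\<^sup>2 * (\<Prod>k=1..r. 1 - p powi (- int k))"
proof (induction r)
  case (Suc r)
  have sq: "(Suc r)\<^sup>2 = r\<^sup>2 + (Suc r + r)" by (simp add: power2_eq_square)
  let ?A = "\<lambda>r. \<Prod>k=1..r. 1 - p powi (- int k)"
  have "(\<Prod>k=1..Suc r. (q ^ k - (q / p) ^ k) * q ^ (k - 1))
      = (q ^ Suc r - (q / p) ^ Suc r) * q ^ r * (\<Prod>k=1..r. (q ^ k - (q / p) ^ k) * q ^ (k - 1))"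
    by (simp add: prod.nat_ivl_Suc')
  also have "\<dots> = q ^ (Suc r)\<^sup>2 * ((1 - inverse (p ^ Suc r)) * ?A r)"
    unfolding Suc sq by (simp add: power_add power_mult_distrib power_inverse divide_inverse algebra_simps)
  also have "(1 - inverse (p ^ Suc r)) * ?A r = ?A (Suc r)"
    by (simp add: prod.nat_ivl_Suc' power_int_minus del: of_nat_Suc power_Suc)
  finally show ?case .
qed simp

theorem theorem7:
  fixes p m r t :: nat
    and \<beta> :: "'a :: nontriv mod_ring"
    and b :: int
  assumes "prime p" and "m \<ge> 1" and "r \<ge> 1"
    and "CARD('a) = p ^ m"
    and "of_int b = \<beta>"
    and "t \<le> m" and "int p ^ t = gcd b (int p ^ m)"
  shows "real (card {X \<in> GL r. mat_trace X = \<beta>}) =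
    (if t = 0
     then real p ^ (m * (r\<^sup>2 - 1)) *
       ((\<Prod>i=1..r. 1 - real p powi (- int i))
         - (- 1) ^ r * real p powi (- int (r * (r + 1) div 2)))
     else real p ^ (m * (r\<^sup>2 - 1)) *
       ((\<Prod>i=1..r. 1 - real p powi (- int i))
         + (- 1) ^ r * real p powi (- int (r * (r + 1) div 2)) * (real p - 1)))"
proof -
  let ?M = "{x :: 'a mod_ring. \<not> x dvd 1}"
  interpret finite_local_ring ?M
    using assms(1,2,4) by (rule finite_local_ring_mod_ring)
  define q where "q = real p ^ m"
  define A where "A = (\<Prod>i=1..r. 1 - real p powi (- int i))"
  define B where "B = (- 1) ^ r * real p powi (- int (r * (r + 1) div 2))"
  have p: "real p > 0" using assms(1) by (simp add: prime_gt_0_nat)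
  then have q: "q > 0" by (simp add: q_def)
  have card_M: "real (card ?M) = q / real p"
    using p assms(2) power_minus_mult[of m "real p"]
    by (simp add: card_nonunits_mod_ring[OF assms(1,2,4)] q_def field_simps)
  have card_R: "real CARD('a) = q"
    by (simp add: assms(4) q_def)
  have "card ?M \<le> CARD('a)"
    using card_mono[of UNIV ?M] by simp
  \<comment> \<open>The order of \<open>GL r\<close> is stated with subtraction of naturals; this
    bound lets it pass to the reals.\<close>
  then have le: "card ?M ^ k \<le> CARD('a) ^ k" for k
    by (rule power_mono) simp
  have "real (card (GL r :: 'a mod_ring mat set)) = (\<Prod>k=1..r. (q ^ k - (q / p) ^ k) * q ^ (k - 1))"
    unfolding card_GL by (simp add: of_nat_diff le card_M card_R)
  then have GL: "real (card (GL r :: 'a mod_ring mat set)) = q ^ r\<^sup>2 * A"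
    unfolding prod_unimodular_counts A_def .
  have P: "real_of_int (\<Prod>k=1..r. - (int (card ?M) ^ k * int CARD('a mod_ring) ^ (k - 1))) = q ^ r\<^sup>2 * B"
    unfolding B_def prod_nonunit_powers[symmetric] by (simp add: card_M card_R)
  \<comment> \<open>As \<open>r\<close> is at least 1, the subtraction in the exponent is not
    truncated.\<close>
  have r2: "q ^ r\<^sup>2 = q * q ^ (r\<^sup>2 - 1)"
    using assms(3) power_minus_mult[of "r\<^sup>2" q] by (simp add: mult.commute)
  have unit: "real (trace_count r x) = q ^ (r\<^sup>2 - 1) * (A - B)" if "x \<notin> ?M" for x
  proof -
    have "q * real (trace_count r x) = q ^ r\<^sup>2 * A - q ^ r\<^sup>2 * B"
      using arg_cong[OF trace_count_unit[OF assms(3) that], of real_of_int] P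
      by (simp add: GL card_R)
    also have "\<dots> = q * (q ^ (r\<^sup>2 - 1) * (A - B))"
      unfolding r2 by (simp add: algebra_simps)
    finally show ?thesis using q by simp
  qed
  \<comment> \<open>Compare with the unit trace 1. The known difference carries the factor
    \<open>q / real p\<close> instead of \<open>q\<close>, so dividing leaves an additional
    \<open>real p\<close>, and \<open>- B + B * real p\<close> is
    \<open>B * (real p - 1)\<close>.\<close>
  have nonunit: "real (trace_count r x) = q ^ (r\<^sup>2 - 1) * (A + B * (real p - 1))" if "x \<in> ?M" for x
  proof -
    have "1 \<notin> ?M" by simp
    have "(q / real p) * (real (trace_count r x) - real (trace_count r 1)) = q ^ r\<^sup>2 * B"
      using arg_cong[OF trace_count_nonunit_diff_unit[OF assms(3) that \<open>1 \<notin> ?M\<close>], of real_of_int] P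
      by (simp add: card_M)
    then have "q * (real (trace_count r x) - real (trace_count r 1)) = q * (q ^ (r\<^sup>2 - 1) * B * real p)"
      unfolding r2 using p by (simp add: field_simps)
    then have "real (trace_count r x) - real (trace_count r 1) = q ^ (r\<^sup>2 - 1) * B * real p"
      using q by simp
    with unit[OF \<open>1 \<notin> ?M\<close>] show ?thesis by (simp add: algebra_simps)
  qed
  \<comment> \<open>The distinction on \<open>t\<close> is the one between units and nonunits, both
    being decided by divisibility of \<open>b\<close> by \<open>p\<close>.\<close>
  have "t = 0 \<longleftrightarrow> \<not> int p dvd b"
  proof
    assume "t = 0"
    then have "gcd b (int p ^ m) = 1" using assms(7) by simp
    then show "\<not> int p dvd b"
      using of_int_mod_ring_prime_power_dvd_1_iff[OF assms(1,2,4), of b]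
        of_int_mod_ring_dvd_1_iff[of b, where 'a = 'a]
      by (simp add: assms(4) coprime_iff_gcd_eq_1)
  next
    assume "\<not> int p dvd b"
    then show "t = 0"
      using assms(7) by (metis dvd_power dvd_trans gcd_dvd1 gr0I)
  qed
  also have "\<dots> \<longleftrightarrow> \<beta> \<notin> ?M"
    using of_int_mod_ring_prime_power_dvd_1_iff[OF assms(1,2,4), of b] assms(5) by simp
  finally have "real (trace_count r \<beta>) =
      (if t = 0 then q ^ (r\<^sup>2 - 1) * (A - B) else q ^ (r\<^sup>2 - 1) * (A + B * (real p - 1)))"
    using unit nonunit by simp
  then show ?thesis
    by (simp only: trace_count_def q_def A_def B_def power_mult)
qed

end
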